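(* Let $\lVert\cdot\rVert_A$ and $\lVert\cdot\rVert_B$ be rearrangement-invariant Banach function norms over $([0,\infty),\lambda)$, with corresponding Banach function spaces $A$ and $B$. Suppose that the local component of $\lVert\cdot\rVert_A$ is stronger than that of $\lVert\cdot\rVert_B$ while the global component of $\lVert\cdot\rVert_B$ is stronger than that of $\lVert\cdot\rVert_A$. Then $$A\cap B=WL(A,B)$$ up to equivalence of quasinorms, while $$A+B=WL(B,A)$$ as sets.
   Context: $\lambda$ is Lebesgue measure on $[0,\infty)$; $M$ is the set of extended complex-valued $\lambda$-measurable functions on $[0,\infty)$ (identified when equal a.e.), $M_+$ the non-negative ones. The non-increasing rearrangement of $f\in M$ is $f^*(t)=\inf\{s\ge 0:\lambda(\{|f|>s\})\le t\}$. A Banach function norm is a map $\lVert\cdot\rVert:M\to[0,\infty]$ with $\lVert\,|f|\,\rVert=\lVert f\rVert$ whose restriction to $M_+$ satisfies: (P1) it is positively homogeneous, $\lVert f\rVert=0\Leftrightarrow f=0$ a.e., and $\lVert f+g\rVert\le\lVert f\rVert+\lVert g\rVert$; (P2) $f\le g$ a.e. implies $\lVert f\rVert\le\lVert g\rVert$; (P3) $f_n\uparrow f$ a.e. implies $\lVert f_n\rVert\uparrow\lVert f\rVert$; (P4) $\lVert\chi_E\rVert<\infty$ whenever $\lambda(E)<\infty$; (P5) for every $E$ with $\lambda(E)<\infty$ there is a finite $C_E$ with $\int_E f\,d\lambda\le C_E\lVert f\rVert$ for all $f\in M_+$. It is rearrangement-invariant (r.i.) if $f^*=g^*$ implies $\lVert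 f\rVert=\lVert g\rVert$. The corresponding Banach function space is $X=\{f\in M:\lVert f\rVert_X<\infty\}$ (its elements are finite a.e.). $\lVert f\rVert_{WL(A,B)}=\lVert f^*\chi_{[0,1]}\rVert_A+\lVert f^*\chi_{(1,\infty)}\rVert_B$ for $f\in M$, and $WL(A,B)=\{f\in M:\lVert f\rVert_{WL(A,B)}<\infty\}$. The local component of $\lVert\cdot\rVert_X$ is stronger than that of $\lVert\cdot\rVert_Y$ if for every $f\in M$: $\lVert f^*\chi_{[0,1]}\rVert_X<\infty\Rightarrow\lVert f^*\chi_{[0,1]}\rVert_Y<\infty$. The global component of $\lVert\cdot\rVert_X$ is stronger than that of $\lVert\cdot\rVert_Y$ if for every $f\in M$ with $f^*(1)<\infty$: $\lVert f^*\chi_{(1,\infty)}\rVert_X<\infty\Rightarrow\lVert f^*\chi_{(1,\infty)}\rVert_Y<\infty$. $A\cap B$ carries the norm $\max\{\lVert f\rVert_A,\lVert f\rVert_B\}$; $A+B=\{g+h:g\in A,h\in B\}$. Quasinorms are equivalent if each is bounded by a constant multiple of the other. *)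

theory Defs
  imports "HOL-Analysis.Analysis"
begin

section \<open>Extended complex-valued measurable functions on the half-line\<close>

text \<open>The extended complex plane has a single point at infinity. The half-line
  \<open>[0, \<infinity>]\<close> (type \<^typ>\<open>ennreal\<close>) embeds into it via \<open>ecomplex_of_ennreal\<close>.\<close>

datatype ecomplex = Fin (fin_part: complex) | CInf
  where "fin_part CInf = 0"

fun modulus :: "ecomplex \<Rightarrow> ennreal" where
  "modulus (Fin z) = ennreal (cmod z)"
| "modulus CInf = \<infinity>"

definition ecomplex_of_ennreal :: "ennreal \<Rightarrow> ecomplex" where
  "ecomplex_of_ennreal a = (if a = \<infinity> then CInf else Fin (complex_of_real (enn2real a)))"

text \<open>Any sum with an infinite summand is infinite. In particular \<open>CInf + CInf = CInf\<close>, which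
  agrees with addition on \<open>[0, \<infinity>]\<close>; for functions that are finite almost everywhere the
  convention is immaterial.\<close>

instantiation ecomplex :: plus
begin

fun plus_ecomplex :: "ecomplex \<Rightarrow> ecomplex \<Rightarrow> ecomplex" where
  "Fin z + Fin w = Fin (z + w)"
| "CInf + _ = CInf"
| "_ + CInf = CInf"

instance ..

end

abbreviation lam :: "real measure" where
  "lam \<equiv> lebesgue_on {0..}"

text \<open>Functions are total on \<^typ>\<open>real\<close>, but their values at negative arguments are never
  inspected. Almost-everywhere equal functions are not identified at the level of types; all
  notions below are invariant under equality \<^term>\<open>lam\<close>-almost everywhere.\<close>

definition mfun :: "(real \<Rightarrow> ecomplex) set" where
  "mfun = {f. {t\<in>{0..}. f t = CInf} \<in> sets lam \<and> (\<lambda>t. fin_part (f t)) \<in> borel_measurable lam}"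

text \<open>The non-negative members of \<open>mfun\<close> are, up to their values at negative arguments, the
  functions \<open>of_pos f\<close> with \<open>f\<close> in \<open>mfun_pos\<close>.\<close>

definition mfun_pos :: "(real \<Rightarrow> ennreal) set" where
  "mfun_pos = borel_measurable lam"

definition of_pos :: "(real \<Rightarrow> ennreal) \<Rightarrow> real \<Rightarrow> ecomplex" where
  "of_pos f = (\<lambda>t. ecomplex_of_ennreal (f t))"

definition rearr :: "(real \<Rightarrow> ecomplex) \<Rightarrow> real \<Rightarrow> ennreal" where
  "rearr f t = (INF s\<in>{s::real. 0 \<le> s \<and>
      emeasure lam {x\<in>{0..}. modulus (f x) > ennreal s} \<le> ennreal t}. ennreal s)"

section \<open>Rearrangement-invariant Banach function norms\<close>

text \<open>Only the values of the norm on \<open>mfun\<close> are meaningful. In \<open>homogeneous\<close>, \<open>\<infinity>\<close> times \<open>0\<close>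
  is \<open>0\<close>, as usual in measure theory.\<close>

locale banach_function_norm =
  fixes N :: "(real \<Rightarrow> ecomplex) \<Rightarrow> ennreal"
  assumes modulus_eq:
      "\<And>f. f \<in> mfun \<Longrightarrow> N (of_pos (\<lambda>t. modulus (f t))) = N f"
    and homogeneous:
      "\<And>f c. f \<in> mfun_pos \<Longrightarrow> 0 \<le> c \<Longrightarrow> N (of_pos (\<lambda>t. ennreal c * f t)) = ennreal c * N (of_pos f)"
    and eq_0_iff:
      "\<And>f. f \<in> mfun_pos \<Longrightarrow> N (of_pos f) = 0 \<longleftrightarrow> (AE t in lam. f t = 0)"
    and triangle:
      "\<And>f g. f \<in> mfun_pos \<Longrightarrow> g \<in> mfun_pos \<Longrightarrow>
         N (of_pos (\<lambda>t. f t + g t)) \<le> N (of_pos f) + N (of_pos g)"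
    and lattice:
      "\<And>f g. f \<in> mfun_pos \<Longrightarrow> g \<in> mfun_pos \<Longrightarrow> (AE t in lam. f t \<le> g t) \<Longrightarrow>
         N (of_pos f) \<le> N (of_pos g)"
    and fatou:
      "\<And>F f. (\<And>n. F n \<in> mfun_pos) \<Longrightarrow> f \<in> mfun_pos \<Longrightarrow>
         (AE t in lam. incseq (\<lambda>n. F n t) \<and> (\<lambda>n. F n t) \<longlonglongrightarrow> f t) \<Longrightarrow>
         incseq (\<lambda>n. N (of_pos (F n))) \<and> (\<lambda>n. N (of_pos (F n))) \<longlonglongrightarrow> N (of_pos f)"
    and finite_indicator:
      "\<And>E. E \<in> sets lam \<Longrightarrow> emeasure lam E < \<infinity> \<Longrightarrow> N (of_pos (indicator E)) < \<infinity>"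
    and locally_integrable:
      "\<And>E. E \<in> sets lam \<Longrightarrow> emeasure lam E < \<infinity> \<Longrightarrow>
         \<exists>C::ennreal. C < \<infinity> \<and> (\<forall>f\<in>mfun_pos. (\<integral>\<^sup>+t\<in>E. f t \<partial>lam) \<le> C * N (of_pos f))"

locale ri_banach_function_norm = banach_function_norm +
  assumes rearrangement_invariant:
    "\<And>f g. f \<in> mfun \<Longrightarrow> g \<in> mfun \<Longrightarrow> (\<forall>t\<ge>0. rearr f t = rearr g t) \<Longrightarrow> N f = N g"

definition space_of :: "((real \<Rightarrow> ecomplex) \<Rightarrow> ennreal) \<Rightarrow> (real \<Rightarrow> ecomplex) set" where
  "space_of N = {f \<in> mfun. N f < \<infinity>}"

section \<open>Local and global components, Wiener--Luxemburg amalgams\<close>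

definition local_part :: "(real \<Rightarrow> ecomplex) \<Rightarrow> real \<Rightarrow> ecomplex" where
  "local_part f = of_pos (\<lambda>t. rearr f t * indicator {0..1} t)"

definition global_part :: "(real \<Rightarrow> ecomplex) \<Rightarrow> real \<Rightarrow> ecomplex" where
  "global_part f = of_pos (\<lambda>t. rearr f t * indicator {1<..} t)"

definition local_stronger ::
  "((real \<Rightarrow> ecomplex) \<Rightarrow> ennreal) \<Rightarrow> ((real \<Rightarrow> ecomplex) \<Rightarrow> ennreal) \<Rightarrow> bool" where
  "local_stronger X Y \<longleftrightarrow> (\<forall>f\<in>mfun. X (local_part f) < \<infinity> \<longrightarrow> Y (local_part f) < \<infinity>)"

definition global_stronger ::
  "((real \<Rightarrow> ecomplex) \<Rightarrow> ennreal) \<Rightarrow> ((real \<Rightarrow> ecomplex) \<Rightarrow> ennreal) \<Rightarrow> bool" where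
  "global_stronger X Y \<longleftrightarrow>
     (\<forall>f\<in>mfun. rearr f 1 < \<infinity> \<longrightarrow> X (global_part f) < \<infinity> \<longrightarrow> Y (global_part f) < \<infinity>)"

definition WL_norm ::
  "((real \<Rightarrow> ecomplex) \<Rightarrow> ennreal) \<Rightarrow> ((real \<Rightarrow> ecomplex) \<Rightarrow> ennreal) \<Rightarrow>
   (real \<Rightarrow> ecomplex) \<Rightarrow> ennreal" where
  "WL_norm A B f = A (local_part f) + B (global_part f)"

definition inter_norm ::
  "((real \<Rightarrow> ecomplex) \<Rightarrow> ennreal) \<Rightarrow> ((real \<Rightarrow> ecomplex) \<Rightarrow> ennreal) \<Rightarrow>
   (real \<Rightarrow> ecomplex) \<Rightarrow> ennreal" where
  "inter_norm A B f = max (A f) (B f)"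

definition sum_space :: "(real \<Rightarrow> ecomplex) set \<Rightarrow> (real \<Rightarrow> ecomplex) set \<Rightarrow>
   (real \<Rightarrow> ecomplex) set" where
  "sum_space S T = {f \<in> mfun. \<exists>g\<in>S. \<exists>h\<in>T. AE t in lam. f t = g t + h t}"

text \<open>The constant is a positive real, so that the two functionals are also infinite
  simultaneously.\<close>

definition equivalent_quasinorms ::
  "((real \<Rightarrow> ecomplex) \<Rightarrow> ennreal) \<Rightarrow> ((real \<Rightarrow> ecomplex) \<Rightarrow> ennreal) \<Rightarrow> bool" where
  "equivalent_quasinorms N N' \<longleftrightarrow>
     (\<exists>C::real. 0 < C \<and> (\<forall>f\<in>mfun. N f \<le> ennreal C * N' f \<and> N' f \<le> ennreal C * N f))"

end

theory Submission imports Defs begin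

text \<open>
  A gliding hump argument turns the qualitative comparison of the components into norm
  inequalities; for the global component the controlling quantity is the whole norm of
  \<open>WL(A, B)\<close>, which also bounds \<open>f\<^sup>*(1)\<close>. This gives the statement about \<open>A \<inter> B\<close>.
  For \<open>A + B\<close>, put \<open>c = f\<^sup>*(1)\<close> and split \<open>f\<close> at the height \<open>c\<close>. The set \<open>{|f| > c}\<close> has
  measure at most 1, so that the local hypothesis applies directly to a summand restricted to
  this set, while \<open>min |f| c \<le> min |g| c + min |h| c\<close> and a truncated summand is controlled by
  its global component. No dilation operators are needed.
\<close>

section \<open>Moduli and measurability of extended complex-valued functions\<close>

lemma modulus_ecomplex_of_ennreal [simp]: "modulus (ecomplex_of_ennreal a) = a"
  by (simp add: ecomplex_of_ennreal_def top.not_eq_extremum)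

lemma modulus_of_pos [simp]: "modulus (of_pos u t) = u t"
  by (simp add: of_pos_def)

lemma modulus_add_le: "modulus (z + w) \<le> modulus z + modulus w"
  by (cases z; cases w) (auto simp: norm_triangle_ineq ennreal_leI simp flip: ennreal_plus)

lemma mfun_pos_modulus:
  assumes "f \<in> mfun"
  shows "(\<lambda>t. modulus (f t)) \<in> mfun_pos"
proof -
  have "modulus z = (if z = CInf then \<infinity> else ennreal (cmod (fin_part z)))" for z
    by (cases z) auto
  moreover have "(\<lambda>t. if f t = CInf then \<infinity> else ennreal (cmod (fin_part (f t)))) \<in> borel_measurable lam"
    using assms by (intro measurable_If) (auto simp: mfun_def)
  ultimately show ?thesis by (simp add: mfun_pos_def)
qed

lemma of_pos_mfun:
  assumes "u \<in> mfun_pos"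
  shows "of_pos u \<in> mfun"
proof -
  have u [measurable]: "u \<in> borel_measurable lam" using assms by (simp add: mfun_pos_def)
  have "{t\<in>space lam. u t = \<infinity>} \<in> sets lam" by measurable
  moreover have "of_pos u t = CInf \<longleftrightarrow> u t = \<infinity>" for t
    by (simp add: of_pos_def ecomplex_of_ennreal_def)
  moreover have "fin_part (of_pos u t) = complex_of_real (enn2real (u t))" for t
    by (simp add: of_pos_def ecomplex_of_ennreal_def)
  ultimately show ?thesis by (simp add: mfun_def)
qed

section \<open>The non-increasing rearrangement\<close>

text \<open>Levels are extended reals so that values of \<open>rearr\<close>, possibly infinite, can
  themselves be inserted as levels.\<close>

definition distr_fun :: "(real \<Rightarrow> ecomplex) \<Rightarrow> ennreal \<Rightarrow> ennreal" where
  "distr_fun f a = emeasure lam {x\<in>{0..}. modulus (f x) > a}"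

lemma sets_modulus_greater:
  assumes "f \<in> mfun"
  shows "{x\<in>{0..}. modulus (f x) > a} \<in> sets lam"
proof -
  have [measurable]: "(\<lambda>t. modulus (f t)) \<in> borel_measurable lam"
    using mfun_pos_modulus[OF assms] by (simp add: mfun_pos_def)
  have "{x\<in>space lam. modulus (f x) > a} \<in> sets lam" by measurable
  then show ?thesis by simp
qed

lemma distr_fun_antimono:
  assumes "f \<in> mfun" "a \<le> b"
  shows "distr_fun f b \<le> distr_fun f a"
  unfolding distr_fun_def
  using assms by (intro emeasure_mono sets_modulus_greater) (auto dest: order.strict_trans1)

text \<open>Right-continuity of the distribution function.\<close>

lemma distr_fun_right_limit_le:
  assumes f: "f \<in> mfun" and le: "\<And>n::nat. distr_fun f (a + ennreal (1 / Suc n)) \<le> b"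
  shows "distr_fun f a \<le> b"
proof (cases "a = \<infinity>")
  case True
  then show ?thesis by (simp add: distr_fun_def)
next
  case False
  let ?S = "\<lambda>n. {x\<in>{0..}. modulus (f x) > a + ennreal (1 / Suc n)}"
  have dec: "a + ennreal (1 / Suc (Suc n)) \<le> a + ennreal (1 / Suc n)" for n
    by (intro add_left_mono ennreal_leI) (simp add: field_simps)
  have "incseq ?S"
    using order.strict_trans1[OF dec] by (intro incseq_SucI) blast
  then have "(SUP n. emeasure lam (?S n)) = emeasure lam (\<Union>n. ?S n)"
    using f by (intro SUP_emeasure_incseq image_subsetI sets_modulus_greater)
  also have "(\<Union>n. ?S n) = {x\<in>{0..}. modulus (f x) > a}"
  proof -
    have "\<exists>n::nat. a + ennreal (1 / Suc n) < y" if "a < y" for y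
    proof -
      have "(\<lambda>n. a + ennreal (1 / Suc n)) \<longlonglongrightarrow> a + ennreal 0"
        by (intro tendsto_intros LIMSEQ_Suc[OF lim_1_over_n])
      then have "eventually (\<lambda>n. a + ennreal (1 / Suc n) < y) sequentially"
        using that by (intro order_tendstoD(2)) auto
      then show ?thesis by (auto simp: eventually_sequentially)
    qed
    moreover have "a \<le> a + c" for c by simp
    ultimately show ?thesis by (blast intro: order.strict_trans1)
  qed
  finally have "distr_fun f a = (SUP n. distr_fun f (a + ennreal (1 / Suc n)))"
    by (simp add: distr_fun_def)
  also have "\<dots> \<le> b" using le by (intro SUP_least)
  finally show ?thesis .
qed

text \<open>Right-continuity of the distribution function lets the infimum itself serve as a level,
  which gives a Galois connection. Later facts about rearrangements are read off from it by
  comparing superlevel sets.\<close>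

lemma rearr_le_iff:
  assumes f: "f \<in> mfun"
  shows "rearr f t \<le> a \<longleftrightarrow> distr_fun f a \<le> ennreal t"
proof
  assume le: "rearr f t \<le> a"
  show "distr_fun f a \<le> ennreal t"
  proof (rule distr_fun_right_limit_le[OF f])
    fix n :: nat
    show "distr_fun f (a + ennreal (1 / Suc n)) \<le> ennreal t"
    proof (cases "a = \<infinity>")
      case True
      then show ?thesis by (simp add: distr_fun_def)
    next
      case False
      \<comment> \<open>Strictness gives room: some \<open>s\<close> admissible in the infimum lies
        below this level.\<close>
      have "a < a + ennreal (1 / Suc n)"
        using False by (cases a) (auto simp: ennreal_less_iff simp flip: ennreal_plus)
      with le have "rearr f t < a + ennreal (1 / Suc n)" by (rule order.strict_trans1)
      then obtain s where "0 \<le> s" "distr_fun f (ennreal s) \<le> ennreal t"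
          "ennreal s < a + ennreal (1 / Suc n)"
        unfolding rearr_def INF_less_iff distr_fun_def by blast
      then show ?thesis using distr_fun_antimono[OF f] by (meson less_imp_le order_trans)
    qed
  qed
next
  assume le: "distr_fun f a \<le> ennreal t"
  show "rearr f t \<le> a"
  proof (cases a)
    case (real s)
    then show ?thesis using le unfolding rearr_def distr_fun_def by (subst real(2)) (intro INF_lower, auto)
  qed auto
qed

lemma less_rearr_iff:
  assumes "f \<in> mfun"
  shows "a < rearr f t \<longleftrightarrow> ennreal t < distr_fun f a"
  using rearr_le_iff[OF assms, of t a] by (simp add: not_le[symmetric])

lemma antimono_rearr:
  assumes "f \<in> mfun" "s \<le> t"
  shows "rearr f t \<le> rearr f s"
  using assms by (meson rearr_le_iff order.refl order_trans ennreal_leI)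

lemma rearr_mfun_pos:
  assumes f: "f \<in> mfun"
  shows "rearr f \<in> mfun_pos"
  unfolding mfun_pos_def
proof (rule borel_measurableI_greater)
  fix a
  have "{x \<in> space lam. a < rearr f x} = {x \<in> space lam. ennreal x < distr_fun f a}"
    by (simp add: less_rearr_iff[OF f])
  also have "\<dots> \<in> sets lam"
  proof -
    have [measurable]: "(\<lambda>x. ennreal x) \<in> borel_measurable lam"
      by (rule measurable_completion[THEN measurable_restrict_space1]) simp
    show ?thesis by measurable
  qed
  finally show "{x \<in> space lam. a < rearr f x} \<in> sets lam" .
qed

text \<open>With \<open>d = distr_fun f a\<close> this set is the superlevel set of
  \<open>rearr f\<close> at height \<open>a\<close>, whence \<open>f\<close> and
  \<open>rearr f\<close> are equimeasurable.\<close>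

lemma emeasure_initial_interval: "emeasure lam {x\<in>{0..}. ennreal x < d} = d"
proof (cases d)
  case (real r)
  then have "{x\<in>{0..}. ennreal x < d} = {0..<r}" by (auto simp: ennreal_less_iff)
  then show ?thesis using real by (subst emeasure_restrict_space) auto
next
  case top
  have "of_nat n \<le> emeasure lebesgue {0::real..}" for n
    using emeasure_mono[of "{0..real n}" "{0..}" lebesgue] by (simp add: ennreal_of_nat_eq_real_of_nat)
  then have "emeasure lebesgue {0::real..} = \<infinity>"
    by (metis ennreal_Ex_less_of_nat infinity_ennreal_def not_le top.not_eq_extremum)
  moreover have "{x\<in>{0..}. ennreal x < d} = {0..}" using top by auto
  ultimately show ?thesis using top by (subst emeasure_restrict_space) simp_all
qed

lemma distr_fun_rearr:
  assumes f: "f \<in> mfun"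
  shows "distr_fun (of_pos (rearr f)) a = distr_fun f a"
  using emeasure_initial_interval[of "distr_fun f a"]
  by (simp add: distr_fun_def[of "of_pos (rearr f)"] less_rearr_iff[OF f])

lemma rearr_rearr:
  assumes f: "f \<in> mfun"
  shows "rearr (of_pos (rearr f)) t = rearr f t"
  using rearr_le_iff[OF f] rearr_le_iff[OF of_pos_mfun[OF rearr_mfun_pos[OF f]]] distr_fun_rearr[OF f]
  by (metis order.refl order.antisym)

lemma rearr_mono:
  assumes f: "f \<in> mfun" and g: "g \<in> mfun" and le: "AE x in lam. modulus (f x) \<le> modulus (g x)"
  shows "rearr f t \<le> rearr g t"
proof -
  have "distr_fun f a \<le> distr_fun g a" for a
    unfolding distr_fun_def using g le
    by (intro emeasure_mono_AE sets_modulus_greater) (auto elim!: eventually_mono)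
  then show ?thesis by (meson rearr_le_iff f g order.refl order_trans)
qed

lemma rearr_eq_0:
  assumes f: "f \<in> mfun" and "emeasure lam {x\<in>{0..}. modulus (f x) \<noteq> 0} \<le> ennreal t"
  shows "rearr f t = 0"
  using assms rearr_le_iff[OF f, of t 0] by (simp add: distr_fun_def zero_less_iff_neq_zero)

text \<open>The superlevel set of \<open>c * u\<close> at height \<open>a\<close> is that of
  \<open>u\<close> at height \<open>a / c\<close>. Thus the functions equal to their own
  rearrangement form a cone.\<close>

lemma rearr_cmult:
  assumes u: "u \<in> mfun_pos" and c: "0 < c"
  shows "rearr (of_pos (\<lambda>x. ennreal c * u x)) t = ennreal c * rearr (of_pos u) t"
proof -
  have *: "y \<le> a / ennreal c \<longleftrightarrow> ennreal c * y \<le> a" for y a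
    using c ennreal_mult_le_mult_iff[of "ennreal c" y "a / ennreal c"]
    by (simp add: ennreal_times_divide ennreal_mult_divide_eq mult.commute[of "ennreal c" a])
  have cu: "(\<lambda>x. ennreal c * u x) \<in> mfun_pos" using u by (simp add: mfun_pos_def)
  have "distr_fun (of_pos (\<lambda>x. ennreal c * u x)) a = distr_fun (of_pos u) (a / ennreal c)" for a
    by (simp add: distr_fun_def not_le[symmetric] *)
  then have "rearr (of_pos (\<lambda>x. ennreal c * u x)) t \<le> a \<longleftrightarrow> ennreal c * rearr (of_pos u) t \<le> a" for a
    by (simp add: rearr_le_iff of_pos_mfun u cu flip: *)
  then show ?thesis by (metis order.refl order.antisym)
qed

text \<open>\<open>u\<close> can exceed \<open>u t\<close> only on \<open>[0, t]\<close>. Equality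
  may fail at jumps: for the indicator of \<open>[0, 1]\<close> the two sides at 1 are 0 and
  1.\<close>

lemma rearr_le_of_antimono:
  assumes u: "u \<in> mfun_pos" and anti: "antimono_on {0..} u" and t: "0 \<le> t"
  shows "rearr (of_pos u) t \<le> u t"
proof -
  have "{x\<in>{0..}. u x > u t} \<subseteq> {0..t}"
  proof safe
    fix x assume x: "0 \<le> x" "u t < u x"
    show "x \<in> {0..t}"
    proof (rule ccontr)
      assume "x \<notin> {0..t}"
      then show False using x t monotone_onD[OF anti, of t x] by auto
    qed
  qed
  then have "emeasure lam {x\<in>{0..}. u x > u t} \<le> emeasure lam {0..t}"
    by (intro emeasure_mono) (auto simp: sets_restrict_space_iff)
  then show ?thesis using t
    by (simp add: rearr_le_iff of_pos_mfun u distr_fun_def emeasure_restrict_space Int_absorb1)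
qed

section \<open>Banach function norms\<close>

context banach_function_norm
begin

text \<open>The triangle inequality for partial sums passes to the limit by the Fatou
  property.\<close>

lemma norm_suminf_le:
  assumes U: "\<And>n. U n \<in> mfun_pos"
  shows "N (of_pos (\<lambda>t. \<Sum>n. U n t)) \<le> (\<Sum>n. N (of_pos (U n)))"
proof -
  have [measurable]: "U n \<in> borel_measurable lam" for n using U by (simp add: mfun_pos_def)
  have partial: "(\<lambda>t. \<Sum>i<n. U i t) \<in> mfun_pos" for n by (simp add: mfun_pos_def)
  have "N (of_pos (\<lambda>t. \<Sum>i<n. U i t)) \<le> (\<Sum>i<n. N (of_pos (U i)))" for n
  proof (induction n)
    case 0
    have "N (of_pos (\<lambda>t. 0)) = 0" by (subst eq_0_iff) (auto simp: mfun_pos_def)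
    then show ?case by simp
  next
    case (Suc n)
    then show ?case
      using triangle[OF partial U, of n n] by (simp add: add_right_mono order_trans)
  qed
  then have bound: "N (of_pos (\<lambda>t. \<Sum>i<n. U i t)) \<le> (\<Sum>n. N (of_pos (U n)))" for n
    by (meson order_trans sum_le_suminf summableI finite_lessThan zero_le)
  have "(\<lambda>n. N (of_pos (\<lambda>t. \<Sum>i<n. U i t))) \<longlonglongrightarrow> N (of_pos (\<lambda>t. \<Sum>n. U n t))"
    by (intro conjunct2[OF fatou] partial AE_I2)
       (auto simp: mfun_pos_def summable_LIMSEQ intro!: incseq_SucI)
  then show ?thesis using bound by (intro LIMSEQ_le_const2) auto
qed

lemma norm_indicator_pos:
  assumes "E \<in> sets lam" "emeasure lam E \<noteq> 0"
  shows "N (of_pos (indicator E)) \<noteq> 0"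
proof -
  have "\<not> (AE t in lam. indicator E t = (0::ennreal))"
    using assms AE_iff_measurable[of E lam "\<lambda>t. indicator E t = (0::ennreal)"] sets.sets_into_space[of E lam]
    by (auto simp: indicator_eq_0_iff)
  then show ?thesis using assms by (subst eq_0_iff) (auto simp: mfun_pos_def)
qed

lemma norm_const_indicator_finite:
  assumes E: "E \<in> sets lam" "emeasure lam E < \<infinity>" and c: "c < \<infinity>"
  shows "N (of_pos (\<lambda>t. c * indicator E t)) < \<infinity>"
  using homogeneous[of "indicator E" "enn2real c"] finite_indicator[OF E] c E
  by (simp add: mfun_pos_def ennreal_mult_less_top)

text \<open>Were \<open>c\<close> infinite, \<open>u\<close> would dominate every multiple of the
  indicator of \<open>E\<close>, whose norm is not zero.\<close>

lemma finite_of_norm_finite: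
  assumes u: "u \<in> mfun_pos" and E: "E \<in> sets lam" "emeasure lam E \<noteq> 0"
    and le: "\<And>t. t \<in> E \<Longrightarrow> c \<le> u t" and fin: "N (of_pos u) < \<infinity>"
  shows "c < \<infinity>"
proof (rule ccontr)
  assume "\<not> c < \<infinity>"
  then have top: "u t = \<infinity>" if "t \<in> E" for t
    using le[OF that] by (auto simp: top.not_eq_extremum[symmetric] top.extremum_unique)
  have le: "ennreal r * N (of_pos (indicator E)) \<le> N (of_pos u)" if "0 \<le> r" for r
    using that u E top
    by (subst homogeneous[symmetric]) (auto intro!: lattice AE_I2 simp: mfun_pos_def indicator_def)
  obtain x where x: "N (of_pos u) = ennreal x" "0 \<le> x" using fin by (cases "N (of_pos u)") auto
  \<comment> \<open>The case \<open>r = 1\<close> makes this norm finite; it is positive because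
    \<open>E\<close> is not a null set.\<close>
  obtain y where y: "N (of_pos (indicator E)) = ennreal y" "0 < y"
    using le[of 1] fin norm_indicator_pos[OF E]
    by (cases "N (of_pos (indicator E))") (auto simp: order.order_iff_strict top_unique)
  \<comment> \<open>This multiple has norm \<open>x + 1\<close>, which exceeds the norm
    \<open>x\<close> of \<open>u\<close>.\<close>
  show False using le[of "(x + 1) / y"] x y by (simp flip: ennreal_mult)
qed

end

context ri_banach_function_norm
begin

lemma norm_rearr:
  assumes f: "f \<in> mfun"
  shows "N (of_pos (rearr f)) = N f"
  using rearrangement_invariant[OF of_pos_mfun[OF rearr_mfun_pos[OF f]] f] rearr_rearr[OF f] by auto

lemma norm_mono:
  assumes f: "f \<in> mfun" and g: "g \<in> mfun" and le: "AE x in lam. modulus (f x) \<le> modulus (g x)"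
  shows "N f \<le> N g"
  using lattice[OF mfun_pos_modulus[OF f] mfun_pos_modulus[OF g] le] by (simp add: modulus_eq f g)

lemma norm_le_of_rearr_le:
  assumes f: "f \<in> mfun" and u: "u \<in> mfun_pos" and le: "\<And>t. 0 \<le> t \<Longrightarrow> rearr f t \<le> u t"
  shows "N f \<le> N (of_pos u)"
  using lattice[OF rearr_mfun_pos[OF f] u AE_I2] le by (simp add: norm_rearr[OF f])

text \<open>On \<open>[0, t]\<close>, a set of positive measure, the rearrangement is at least
  \<open>rearr f t\<close>.\<close>

lemma rearr_finite:
  assumes f: "f \<in> mfun" "N f < \<infinity>" and t: "0 < t"
  shows "rearr f t < \<infinity>"
proof (rule finite_of_norm_finite[OF rearr_mfun_pos[OF f(1)]])
  show "{0..t} \<in> sets lam" "emeasure lam {0..t} \<noteq> 0"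
    using t by (auto simp: sets_restrict_space_iff emeasure_restrict_space Int_absorb1)
qed (use f in \<open>auto simp: norm_rearr antimono_rearr\<close>)

end

section \<open>Restriction to measurable sets and rearrangement of sums\<close>

lemma mfun_pos_indicator:
  assumes "u \<in> mfun_pos" "S \<in> sets lam"
  shows "(\<lambda>t. u t * indicator S t) \<in> mfun_pos"
  using assms by (simp add: mfun_pos_def)

lemma mfun_restrict:
  assumes f: "f \<in> mfun" and S: "S \<in> sets lam"
  shows "(\<lambda>t. if t \<in> S then f t else Fin 0) \<in> mfun"
proof -
  have [measurable]: "{t\<in>{0..}. f t = CInf} \<in> sets lam" "(\<lambda>t. fin_part (f t)) \<in> borel_measurable lam"
    "S \<in> sets lam"
    using f S by (auto simp: mfun_def)
  have "{t\<in>{0..}. (if t \<in> S then f t else Fin 0) = CInf} = {t\<in>{0..}. f t = CInf} \<inter> S" by auto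
  also have "\<dots> \<in> sets lam" by measurable
  finally have "{t\<in>{0..}. (if t \<in> S then f t else Fin 0) = CInf} \<in> sets lam" .
  moreover have "fin_part (if t \<in> S then f t else Fin 0) = (if t \<in> S then fin_part (f t) else 0)" for t
    by simp
  ultimately show ?thesis by (simp add: mfun_def)
qed

lemma unit_split_lam:
  "{0..1} \<in> sets lam" "{1<..} \<in> sets lam" "emeasure lam {0..1} = 1"
  by (auto simp: sets_restrict_space_iff emeasure_restrict_space)

text \<open>A sum can exceed \<open>a + b\<close> only where the first summand exceeds
  \<open>a\<close> or the second exceeds \<open>b\<close>.\<close>

lemma distr_fun_add_le:
  assumes f: "f \<in> mfun" and g: "g \<in> mfun" and h: "h \<in> mfun"
    and le: "AE x in lam. modulus (f x) \<le> modulus (g x) + modulus (h x)"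
  shows "distr_fun f (a + b) \<le> distr_fun g a + distr_fun h b"
proof -
  let ?G = "{x\<in>{0..}. modulus (g x) > a}" and ?H = "{x\<in>{0..}. modulus (h x) > b}"
  have sets: "?G \<in> sets lam" "?H \<in> sets lam" by (intro sets_modulus_greater g h)+
  have "distr_fun f (a + b) \<le> emeasure lam (?G \<union> ?H)"
    unfolding distr_fun_def
  proof (rule emeasure_mono_AE)
    show "AE x in lam. x \<in> {x\<in>{0..}. modulus (f x) > a + b} \<longrightarrow> x \<in> ?G \<union> ?H"
      using le
    proof (rule eventually_mono)
      fix x assume le: "modulus (f x) \<le> modulus (g x) + modulus (h x)"
      show "x \<in> {x\<in>{0..}. modulus (f x) > a + b} \<longrightarrow> x \<in> ?G \<union> ?H"
        using order_trans[OF le add_mono[of "modulus (g x)" a "modulus (h x)" b]]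
        by (auto simp: not_le[symmetric])
    qed
  qed (use sets in auto)
  also have "\<dots> \<le> distr_fun g a + distr_fun h b"
    unfolding distr_fun_def by (rule emeasure_subadditive[OF sets])
  finally show ?thesis .
qed

text \<open>At the levels \<open>rearr g s\<close> and \<open>rearr h t\<close> the distribution
  functions of \<open>g\<close> and \<open>h\<close> are at most \<open>s\<close> and
  \<open>t\<close>.\<close>

lemma rearr_add_le:
  assumes f: "f \<in> mfun" and g: "g \<in> mfun" and h: "h \<in> mfun"
    and le: "AE x in lam. modulus (f x) \<le> modulus (g x) + modulus (h x)"
    and "0 \<le> s" "0 \<le> t"
  shows "rearr f (s + t) \<le> rearr g s + rearr h t"
  unfolding rearr_le_iff[OF f]
proof (rule order_trans[OF distr_fun_add_le[OF f g h le]])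
  show "distr_fun g (rearr g s) + distr_fun h (rearr h t) \<le> ennreal (s + t)"
    using assms(5,6) by (simp add: add_mono flip: rearr_le_iff[OF g] rearr_le_iff[OF h])
qed

lemma local_part_mfun: "f \<in> mfun \<Longrightarrow> local_part f \<in> mfun"
  and global_part_mfun: "f \<in> mfun \<Longrightarrow> global_part f \<in> mfun"
  unfolding local_part_def global_part_def
  by (intro of_pos_mfun mfun_pos_indicator rearr_mfun_pos unit_split_lam; assumption)+

section \<open>Norms of local and global parts\<close>

context ri_banach_function_norm
begin

lemma norm_add_le:
  assumes f: "f \<in> mfun" and g: "g \<in> mfun" and h: "h \<in> mfun"
    and le: "AE x in lam. modulus (f x) \<le> modulus (g x) + modulus (h x)"
  shows "N f \<le> N g + N h"
proof -
  note m = mfun_pos_modulus[OF f] mfun_pos_modulus[OF g] mfun_pos_modulus[OF h]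
  have "(\<lambda>t. modulus (g t) + modulus (h t)) \<in> mfun_pos"
    using m by (simp add: mfun_pos_def)
  from order_trans[OF lattice[OF m(1) this le] triangle[OF m(2,3)]]
  show ?thesis by (simp add: modulus_eq f g h)
qed

lemma norm_local_part_le:
  assumes f: "f \<in> mfun" shows "N (local_part f) \<le> N f"
  using norm_mono[OF local_part_mfun[OF f] of_pos_mfun[OF rearr_mfun_pos[OF f]]]
  by (simp add: norm_rearr[OF f] local_part_def indicator_def)

lemma norm_global_part_le:
  assumes f: "f \<in> mfun" shows "N (global_part f) \<le> N f"
  using norm_mono[OF global_part_mfun[OF f] of_pos_mfun[OF rearr_mfun_pos[OF f]]]
  by (simp add: norm_rearr[OF f] global_part_def indicator_def)

lemma norm_le_local_global:
  assumes f: "f \<in> mfun" shows "N f \<le> N (local_part f) + N (global_part f)"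
proof -
  have "N (of_pos (rearr f)) \<le> N (local_part f) + N (global_part f)"
    by (intro norm_add_le local_part_mfun global_part_mfun of_pos_mfun[OF rearr_mfun_pos] f AE_I2)
       (auto simp: local_part_def global_part_def indicator_def)
  then show ?thesis by (simp add: norm_rearr[OF f])
qed

text \<open>The rearrangement of such an \<open>f\<close> vanishes beyond 1. Hence a comparison of
  local components applies to the full norm of \<open>f\<close>.\<close>

lemma norm_local_part_eq:
  assumes f: "f \<in> mfun" and supp: "emeasure lam {x\<in>{0..}. modulus (f x) \<noteq> 0} \<le> 1"
  shows "N (local_part f) = N f"
proof (rule antisym[OF norm_local_part_le[OF f]])
  have "rearr f t \<le> rearr f t * indicator {0..1} t" if "0 \<le> t" for t
    using that rearr_eq_0[OF f, of t] order_trans[OF supp, of "ennreal t"] by (auto simp: indicator_def)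
  then show "N f \<le> N (local_part f)"
    unfolding local_part_def
    by (intro norm_le_of_rearr_le f mfun_pos_indicator rearr_mfun_pos unit_split_lam)
qed

text \<open>On \<open>[0, 1]\<close> the function is at least \<open>u 1\<close>. This supplies the
  finiteness at 1 that the comparison of global components asks for.\<close>

lemma antimono_finite_at_1:
  assumes u: "u \<in> mfun_pos" and anti: "antimono_on {0..} u"
    and fin: "N (of_pos (\<lambda>t. u t * indicator {0..1} t)) < \<infinity>"
  shows "u 1 < \<infinity>"
  by (rule finite_of_norm_finite[OF mfun_pos_indicator[OF u unit_split_lam(1)] _ _ _ fin])
     (use unit_split_lam anti in \<open>auto simp: monotone_on_def\<close>)

text \<open>The rearrangement of \<open>k\<close> is at most \<open>c\<close> on
  \<open>[0, 1]\<close> and at most that of \<open>f\<close> on the rest, and a finite multiple of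
  the indicator of \<open>[0, 1]\<close> has finite norm.\<close>

lemma norm_truncated_finite:
  assumes k: "k \<in> mfun" and f: "f \<in> mfun" and c: "c < \<infinity>"
    and le_c: "\<And>t. 0 \<le> t \<Longrightarrow> modulus (k t) \<le> c"
    and le_f: "\<And>t. 0 \<le> t \<Longrightarrow> modulus (k t) \<le> modulus (f t)"
    and fin: "N (global_part f) < \<infinity>"
  shows "N k < \<infinity>"
proof -
  have const: "(\<lambda>t. c * indicator {0..1} t) \<in> mfun_pos"
    using unit_split_lam(1) by (simp add: mfun_pos_def)
  have glob: "(\<lambda>t. rearr f t * indicator {1<..} t) \<in> mfun_pos"
    by (intro mfun_pos_indicator rearr_mfun_pos f unit_split_lam)
  have "{x\<in>{0..}. modulus (k x) > c} = {}" using le_c by (auto simp: not_less[symmetric])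
  then have "rearr k t \<le> c" for t by (simp add: rearr_le_iff[OF k] distr_fun_def del: Collect_empty_eq)
  moreover have "rearr k t \<le> rearr f t" for t
    by (intro rearr_mono k f AE_I2) (simp add: le_f)
  ultimately have "N k \<le> N (of_pos (\<lambda>t. c * indicator {0..1} t + rearr f t * indicator {1<..} t))"
    using const glob by (intro norm_le_of_rearr_le k) (auto simp: mfun_pos_def indicator_def)
  also have "\<dots> \<le> N (of_pos (\<lambda>t. c * indicator {0..1} t)) + N (global_part f)"
    unfolding global_part_def by (intro triangle const glob)
  also have "\<dots> < \<infinity>"
    using fin norm_const_indicator_finite[OF unit_split_lam(1) _ c] unit_split_lam(3) by simp
  finally show ?thesis .
qed

end

section \<open>Embeddings of the components\<close>

text \<open>The gliding hump in abstract form: if no constant works, scaling inside the cone yields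
  a sequence with \<open>p\<close> summable and \<open>q\<close> unbounded. Each application proves
  \<open>bounded\<close> by summing the sequence in its own way.\<close>

lemma domination_of_finiteness:
  fixes p q :: "('a \<Rightarrow> ennreal) \<Rightarrow> ennreal"
  assumes cone: "\<And>u c. u \<in> K \<Longrightarrow> 0 < c \<Longrightarrow> (\<lambda>x. ennreal c * u x) \<in> K"
    and p: "\<And>u c. u \<in> K \<Longrightarrow> 0 < c \<Longrightarrow> p (\<lambda>x. ennreal c * u x) = ennreal c * p u"
    and q: "\<And>u c. u \<in> K \<Longrightarrow> 0 < c \<Longrightarrow> q (\<lambda>x. ennreal c * u x) = ennreal c * q u"
    and bounded: "\<And>U. (\<And>n. U n \<in> K) \<Longrightarrow> (\<Sum>n. p (U n)) < \<infinity> \<Longrightarrow> \<exists>M<\<infinity>. \<forall>n::nat. q (U n) \<le> M"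
  shows "\<exists>C>0. \<forall>u\<in>K. q u \<le> ennreal C * p u"
proof (rule ccontr)
  assume "\<not> ?thesis"
  then have neg: "\<exists>u\<in>K. ennreal C * p u < q u" if "C > 0" for C
    using that by (auto simp: not_le)
  have "\<exists>w\<in>K. p w \<le> ennreal ((1/2) ^ n) \<and> ennreal (2 ^ n) \<le> q w" for n
  proof -
    \<comment> \<open>The factor \<open>4 ^ n\<close> is large enough that scaling \<open>p\<close>
      down to \<open>(1/2) ^ n\<close> still leaves \<open>q\<close> at least
      \<open>2 ^ n\<close>.\<close>
    obtain u where u: "u \<in> K" and less: "ennreal (4 ^ n) * p u < q u" using neg[of "4 ^ n"] by auto
    have "p u \<noteq> \<infinity>" using less by (auto simp: ennreal_mult_top)
    then obtain a where a: "p u = ennreal a" "0 \<le> a" by (cases "p u") auto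
    have scaled: ?thesis if c: "0 < c" "c * a \<le> (1/2) ^ n" "ennreal (2 ^ n) \<le> ennreal c * q u" for c
      using c a u cone p q by (intro bexI[of _ "\<lambda>x. ennreal c * u x"])
        (auto simp flip: ennreal_mult intro!: ennreal_leI)
    show ?thesis
    proof (cases "a = 0")
      \<comment> \<open>When \<open>p u = 0\<close>, scaling keeps \<open>p\<close> at zero, so the
        factor only has to lift \<open>q\<close> to \<open>2 ^ n\<close>.\<close>
      case True
      show ?thesis
      proof (cases "q u")
        case (real b)
        then have "0 < b" using less by (auto simp: a True ennreal_less_iff)
        then show ?thesis using real True by (intro scaled[of "2 ^ n / b"]) (auto simp flip: ennreal_mult)
      next
        case top
        then show ?thesis using True by (intro scaled[of 1]) auto
      qed
    next
      case False
      let ?c = "(1/2) ^ n / a"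
      have "ennreal (2 ^ n) = ennreal ?c * (ennreal (4 ^ n) * p u)"
        using False a power_mult_distrib[of "2::real" 2 n] by (simp add: power_divide flip: ennreal_mult)
      also have "\<dots> \<le> ennreal ?c * q u" using less by (intro mult_left_mono) auto
      finally show ?thesis using False a by (intro scaled[of ?c]) auto
    qed
  qed
  then obtain U where U: "\<And>n. U n \<in> K" "\<And>n. p (U n) \<le> ennreal ((1/2) ^ n)" "\<And>n. ennreal (2 ^ n) \<le> q (U n)"
    by metis
  have "(\<Sum>n. p (U n)) \<le> (\<Sum>n. ennreal ((1/2) ^ n))" by (intro suminf_le U) auto
  also have "\<dots> < \<infinity>" by (subst suminf_ennreal2) (auto intro: summable_geometric)
  finally obtain M where "M < \<infinity>" "\<And>n. q (U n) \<le> M" using bounded U(1) by metis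
  then have M: "ennreal (2 ^ n) \<le> M" for n using U(3) order_trans by metis
  obtain r where r: "M = ennreal r" "0 \<le> r" using \<open>M < \<infinity>\<close> by (cases M) auto
  obtain n where "r < 2 ^ n" using real_arch_pow[of 2 r] by auto
  with M[of n] r show False by simp
qed

text \<open>The gliding hump runs over functions vanishing beyond 1. Their sum vanishes there too,
  so its norms are those of its local part and \<open>local_stronger\<close> applies to it.\<close>

lemma local_embedding:
  assumes "ri_banach_function_norm A" "ri_banach_function_norm B" "local_stronger A B"
  shows "\<exists>C>0. \<forall>u\<in>mfun_pos. (\<forall>t>1. u t = 0) \<longrightarrow> B (of_pos u) \<le> ennreal C * A (of_pos u)"
proof -
  interpret A: ri_banach_function_norm A by fact
  interpret B: ri_banach_function_norm B by fact
  let ?K = "{u\<in>mfun_pos. \<forall>t>1. u t = 0}"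
  have "\<exists>C>0. \<forall>u\<in>?K. B (of_pos u) \<le> ennreal C * A (of_pos u)"
  proof (rule domination_of_finiteness)
    fix U :: "nat \<Rightarrow> real \<Rightarrow> ennreal"
    assume U: "\<And>n. U n \<in> ?K" and fin: "(\<Sum>n. A (of_pos (U n))) < \<infinity>"
    define v where "v = (\<lambda>t. \<Sum>n. U n t)"
    have [measurable]: "U n \<in> borel_measurable lam" for n using U by (simp add: mfun_pos_def)
    have v: "v \<in> mfun_pos" by (simp add: mfun_pos_def v_def)
    have "v t = 0" if "1 < t" for t using U that by (simp add: v_def)
    then have "{x\<in>{0..}. v x \<noteq> 0} \<subseteq> {0..1}" by (force simp: not_less[symmetric])
    from emeasure_mono[OF this unit_split_lam(1)]
    have supp: "emeasure lam {x\<in>{0..}. modulus (of_pos v x) \<noteq> 0} \<le> 1"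
      by (simp add: unit_split_lam(3))
    have "A (of_pos v) \<le> (\<Sum>n. A (of_pos (U n)))"
      unfolding v_def using U by (intro A.norm_suminf_le) auto
    with fin have "A (of_pos v) < \<infinity>" by simp
    then have "B (of_pos v) < \<infinity>"
      using assms(3) of_pos_mfun[OF v] A.norm_local_part_eq[OF of_pos_mfun[OF v] supp]
        B.norm_local_part_eq[OF of_pos_mfun[OF v] supp] by (auto simp: local_stronger_def)
    moreover have "B (of_pos (U n)) \<le> B (of_pos v)" for n
      using U v sum_le_suminf[of "\<lambda>n. U n _" "{n}"] by (intro B.lattice AE_I2) (auto simp: v_def)
    ultimately show "\<exists>M<\<infinity>. \<forall>n. B (of_pos (U n)) \<le> M" by blast
  qed (auto simp: A.homogeneous B.homogeneous mfun_pos_def)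
  then show ?thesis by auto
qed

text \<open>Finiteness of the \<open>B\<close>-norm of the global part need not make
  \<open>rearr f 1\<close> finite, as \<open>global_stronger\<close> requires; the local term in
  \<open>WL_norm\<close> does.\<close>

lemma global_embedding:
  assumes "ri_banach_function_norm A" "ri_banach_function_norm B" "global_stronger B A"
  shows "\<exists>C>0. \<forall>f\<in>mfun. A (global_part f) \<le> ennreal C * WL_norm A B f"
proof -
  interpret A: ri_banach_function_norm A by fact
  interpret B: ri_banach_function_norm B by fact
  \<comment> \<open>For a function equal to its own rearrangement, \<open>?l\<close> and
    \<open>?g\<close> give exactly its local and global parts.\<close>
  let ?K = "{u\<in>mfun_pos. \<forall>t. rearr (of_pos u) t = u t}"
  let ?l = "\<lambda>u t. u t * indicator {0..1} t :: ennreal" and ?g = "\<lambda>u t. u t * indicator {1<..} t :: ennreal"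
  have lg: "?l u \<in> mfun_pos" "?g u \<in> mfun_pos" if "u \<in> mfun_pos" for u
    using that by (intro mfun_pos_indicator unit_split_lam; assumption)+
  have "\<exists>C>0. \<forall>u\<in>?K. A (of_pos (?g u)) \<le> ennreal C * (A (of_pos (?l u)) + B (of_pos (?g u)))"
  proof (rule domination_of_finiteness)
    fix U :: "nat \<Rightarrow> real \<Rightarrow> ennreal"
    assume U: "\<And>n. U n \<in> ?K" and fin: "(\<Sum>n. A (of_pos (?l (U n))) + B (of_pos (?g (U n)))) < \<infinity>"
    define v where "v = (\<lambda>t. \<Sum>n. U n t)"
    have [measurable]: "U n \<in> borel_measurable lam" for n using U by (simp add: mfun_pos_def)
    have v: "v \<in> mfun_pos" by (simp add: mfun_pos_def v_def)
    have le: "U n t \<le> v t" for n t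
      using sum_le_suminf[of "\<lambda>n. U n t" "{n}"] by (simp add: v_def)
    have anti: "antimono_on {0..} v"
    proof (rule monotone_onI)
      fix s t :: real assume "s \<le> t"
      have "U n t \<le> U n s" for n
        using U[of n] antimono_rearr[OF of_pos_mfun \<open>s \<le> t\<close>, of "U n"] by simp
      then show "v t \<le> v s" unfolding v_def by (intro suminf_le) auto
    qed
    \<comment> \<open>The local terms of the convergent series make the sum \<open>v\<close> finite
      at 1.\<close>
    have "A (of_pos (?l v)) \<le> (\<Sum>n. A (of_pos (?l (U n))))"
      using A.norm_suminf_le[of "\<lambda>n. ?l (U n)"] lg U by (simp add: v_def)
    also have "\<dots> \<le> (\<Sum>n. A (of_pos (?l (U n))) + B (of_pos (?g (U n))))" by (intro suminf_le) auto
    finally have "A (of_pos (?l v)) < \<infinity>" using fin by simp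
    with v anti have "v 1 < \<infinity>" by (rule A.antimono_finite_at_1)
    \<comment> \<open>\<open>v\<close> is not shown to be its own rearrangement. This upper bound
      controls the \<open>B\<close>-norm of its global part, and the lower bound
      \<open>U n t \<le> rearr (of_pos v) t\<close> bounds the terms.\<close>
    moreover have rearr_v: "rearr (of_pos v) t \<le> v t" if "0 \<le> t" for t
      using v anti that by (rule rearr_le_of_antimono)
    ultimately have v1: "rearr (of_pos v) 1 < \<infinity>" using order.strict_trans1[OF rearr_v] by auto
    have "B (global_part (of_pos v)) \<le> B (of_pos (?g v))"
      unfolding global_part_def using rearr_v lg rearr_mfun_pos of_pos_mfun v
      by (intro B.lattice AE_I2 mult_right_mono) auto
    also have "\<dots> \<le> (\<Sum>n. B (of_pos (?g (U n))))"
      using B.norm_suminf_le[of "\<lambda>n. ?g (U n)"] lg U by (simp add: v_def)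
    also have "\<dots> \<le> (\<Sum>n. A (of_pos (?l (U n))) + B (of_pos (?g (U n))))" by (intro suminf_le) auto
    finally have "A (global_part (of_pos v)) < \<infinity>"
      using fin v1 assms(3) of_pos_mfun[OF v] by (auto simp: global_stronger_def)
    moreover have "A (of_pos (?g (U n))) \<le> A (global_part (of_pos v))" for n
    proof -
      have "U n t \<le> rearr (of_pos v) t" for t
        using rearr_mono[of "of_pos (U n)" "of_pos v" t] U v le by (simp add: of_pos_mfun)
      then show ?thesis
        unfolding global_part_def using lg rearr_mfun_pos of_pos_mfun v U
        by (intro A.lattice AE_I2 mult_right_mono) auto
    qed
    ultimately show "\<exists>M<\<infinity>. \<forall>n. A (of_pos (?g (U n))) \<le> M" by blast
  next
    fix u and c :: real assume "u \<in> ?K" "0 < c"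
    then show "(\<lambda>x. ennreal c * u x) \<in> ?K"
      by (auto simp: rearr_cmult) (simp add: mfun_pos_def)
  qed (auto simp: A.homogeneous B.homogeneous lg mult.assoc distrib_left)
  then obtain C where C: "C > 0"
    "\<And>u. u \<in> ?K \<Longrightarrow> A (of_pos (?g u)) \<le> ennreal C * (A (of_pos (?l u)) + B (of_pos (?g u)))" by blast
  have "rearr f \<in> ?K" if "f \<in> mfun" for f using that by (simp add: rearr_rearr rearr_mfun_pos)
  then show ?thesis using C unfolding WL_norm_def local_part_def global_part_def by blast
qed

section \<open>The intersection\<close>

text \<open>Each norm is at most the sum of its values on the two parts. The embeddings bound the
  two values missing from \<open>WL_norm A B\<close>: \<open>B\<close> on the local part and
  \<open>A\<close> on the global part.\<close>

lemma inter_norm_equiv_WL_norm: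
  assumes "ri_banach_function_norm A" "ri_banach_function_norm B"
    and "local_stronger A B" "global_stronger B A"
  shows "equivalent_quasinorms (inter_norm A B) (WL_norm A B)"
proof -
  interpret A: ri_banach_function_norm A by fact
  interpret B: ri_banach_function_norm B by fact
  obtain C where C: "C > 0" "\<And>u. u \<in> mfun_pos \<Longrightarrow> (\<forall>t>1. u t = 0) \<Longrightarrow> B (of_pos u) \<le> ennreal C * A (of_pos u)"
    using local_embedding[OF assms(1-3)] by blast
  obtain D where D: "D > 0" "\<And>f. f \<in> mfun \<Longrightarrow> A (global_part f) \<le> ennreal D * WL_norm A B f"
    using global_embedding[OF assms(1,2,4)] by blast
  \<comment> \<open>The constant dominates the three that arise: \<open>1 + D\<close>,
    \<open>C + 1\<close> and \<open>2\<close>.\<close>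
  have "inter_norm A B f \<le> ennreal (2 + C + D) * WL_norm A B f \<and>
      WL_norm A B f \<le> ennreal (2 + C + D) * inter_norm A B f" if f: "f \<in> mfun" for f
  proof
    let ?W = "WL_norm A B f"
    have up: "ennreal E * x \<le> ennreal (2 + C + D) * x" if "E \<le> 2 + C + D" for E x
      using that by (intro mult_right_mono ennreal_leI) auto
    have "A f \<le> A (local_part f) + A (global_part f)" by (rule A.norm_le_local_global[OF f])
    also have "\<dots> \<le> ?W + ennreal D * ?W" using D(2)[OF f] by (intro add_mono) (simp_all add: WL_norm_def)
    also have "\<dots> = ennreal (1 + D) * ?W" using D(1) by (simp add: distrib_right)
    also have "\<dots> \<le> ennreal (2 + C + D) * ?W" using C(1) by (intro up) simp
    finally have A: "A f \<le> ennreal (2 + C + D) * ?W" .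
    have "B f \<le> B (local_part f) + B (global_part f)" by (rule B.norm_le_local_global[OF f])
    also have "B (local_part f) \<le> ennreal C * A (local_part f)"
      unfolding local_part_def
      by (intro C(2) mfun_pos_indicator rearr_mfun_pos f unit_split_lam) auto
    also have "ennreal C * A (local_part f) + B (global_part f) \<le> ennreal C * ?W + ?W"
      by (intro add_mono mult_left_mono) (simp_all add: WL_norm_def)
    also have "\<dots> = ennreal (C + 1) * ?W" using C(1) by (simp add: distrib_right)
    also have "\<dots> \<le> ennreal (2 + C + D) * ?W" using D(1) by (intro up) simp
    finally show "inter_norm A B f \<le> ennreal (2 + C + D) * ?W" using A by (simp add: inter_norm_def)
    have "?W \<le> A f + B f"
      unfolding WL_norm_def by (intro add_mono A.norm_local_part_le B.norm_global_part_le f)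
    also have "\<dots> \<le> inter_norm A B f + inter_norm A B f"
      by (intro add_mono) (simp_all add: inter_norm_def)
    also have "\<dots> = ennreal 2 * inter_norm A B f" by (simp add: mult_2)
    also have "\<dots> \<le> ennreal (2 + C + D) * inter_norm A B f" using C(1) D(1) by (intro up) simp
    finally show "?W \<le> ennreal (2 + C + D) * inter_norm A B f" .
  qed
  moreover have "0 < 2 + C + D" using C(1) D(1) by simp
  ultimately show ?thesis unfolding equivalent_quasinorms_def by blast
qed

lemma space_of_eq_of_equivalent:
  assumes "equivalent_quasinorms N N'"
  shows "space_of N = space_of N'"
proof -
  obtain C :: real where C: "\<And>f. f \<in> mfun \<Longrightarrow> N f \<le> ennreal C * N' f \<and> N' f \<le> ennreal C * N f"
    using assms unfolding equivalent_quasinorms_def by blast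
  have "N f < \<infinity> \<longleftrightarrow> N' f < \<infinity>" if "f \<in> mfun" for f
    using C[OF that] by (metis ennreal_less_top ennreal_mult_less_top infinity_ennreal_def order.strict_trans1)
  then show ?thesis by (auto simp: space_of_def)
qed

section \<open>The sum space\<close>

text \<open>Where \<open>|f| > c\<close>, a set of measure at most 1, \<open>f\<close> is controlled
  by its local part and goes into \<open>B\<close>. The remainder is bounded by \<open>c\<close> and
  goes into \<open>A\<close>.\<close>

lemma WL_subset_sum_space:
  assumes "ri_banach_function_norm A" "ri_banach_function_norm B"
  shows "space_of (WL_norm B A) \<subseteq> sum_space (space_of A) (space_of B)"
proof
  interpret A: ri_banach_function_norm A by fact
  interpret B: ri_banach_function_norm B by fact
  fix f assume "f \<in> space_of (WL_norm B A)"
  then have f: "f \<in> mfun" and loc: "B (local_part f) < \<infinity>" and glob: "A (global_part f) < \<infinity>"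
    by (auto simp: space_of_def WL_norm_def)
  define c where "c = rearr f 1"
  have "antimono_on {0..} (rearr f)" using f by (intro monotone_onI) (rule antimono_rearr)
  from B.antimono_finite_at_1[OF rearr_mfun_pos[OF f] this] have c: "c < \<infinity>"
    using loc unfolding c_def local_part_def .
  define S where "S = {x\<in>{0..}. modulus (f x) > c}"
  have S: "S \<in> sets lam" unfolding S_def using f by (rule sets_modulus_greater)
  have "emeasure lam S \<le> 1"
    using rearr_le_iff[OF f, of 1 c] by (simp add: c_def S_def distr_fun_def)
  define h where "h = (\<lambda>t. if t \<in> S then f t else Fin 0)"
  define g where "g = (\<lambda>t. if t \<in> space lam - S then f t else Fin 0)"
  have h: "h \<in> mfun" unfolding h_def using f S by (rule mfun_restrict)
  have g: "g \<in> mfun" unfolding g_def using f S by (intro mfun_restrict) auto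
  have "{x\<in>{0..}. modulus (h x) \<noteq> 0} \<subseteq> S" by (auto simp: h_def split: if_splits)
  from order_trans[OF emeasure_mono[OF this S] \<open>emeasure lam S \<le> 1\<close>]
  have "B h = B (local_part h)" by (intro B.norm_local_part_eq[symmetric] h)
  also have "\<dots> \<le> B (local_part f)"
    unfolding local_part_def using f h
    by (intro B.lattice mfun_pos_indicator rearr_mfun_pos unit_split_lam AE_I2 mult_right_mono rearr_mono)
       (auto simp: h_def)
  finally have "h \<in> space_of B" using loc h by (simp add: space_of_def)
  moreover have "A g < \<infinity>"
    by (rule A.norm_truncated_finite[OF g f c _ _ glob]) (auto simp: g_def S_def)
  then have "g \<in> space_of A" using g by (simp add: space_of_def)
  \<comment> \<open>One summand is \<open>Fin 0\<close> at each point, so the identity also holds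
    where \<open>f\<close> is infinite.\<close>
  moreover have "f t = g t + h t" if "0 \<le> t" for t
    using that by (cases "f t") (auto simp: g_def h_def)
  then have "AE t in lam. f t = g t + h t" by (intro AE_I2) simp
  ultimately show "f \<in> sum_space (space_of A) (space_of B)"
    using f unfolding sum_space_def by blast
qed

text \<open>The restriction of \<open>f\<close> to \<open>{|f| > c}\<close> governs the local part
  and the truncation \<open>min |f| c\<close> the global part. Both operations respect the bound
  \<open>|f| \<le> |g| + |h|\<close>.\<close>

lemma sum_space_subset_WL:
  assumes "ri_banach_function_norm A" "ri_banach_function_norm B"
    and "local_stronger A B" "global_stronger B A"
  shows "sum_space (space_of A) (space_of B) \<subseteq> space_of (WL_norm B A)"
proof
  interpret A: ri_banach_function_norm A by fact
  interpret B: ri_banach_function_norm B by fact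
  fix f assume "f \<in> sum_space (space_of A) (space_of B)"
  then obtain g h where f: "f \<in> mfun" and g: "g \<in> mfun" "A g < \<infinity>" and h: "h \<in> mfun" "B h < \<infinity>"
    and sum: "AE t in lam. f t = g t + h t"
    by (auto simp: sum_space_def space_of_def)
  have le: "AE t in lam. modulus (f t) \<le> modulus (g t) + modulus (h t)"
    using sum by (rule eventually_mono) (simp add: modulus_add_le)
  define c where "c = rearr f 1"
  \<comment> \<open>Both halves are positive arguments, where the rearrangements of \<open>g\<close>
    and \<open>h\<close> are finite.\<close>
  have "c \<le> rearr g (1/2) + rearr h (1/2)"
    using rearr_add_le[OF f g(1) h(1) le, of "1/2" "1/2"] by (simp add: c_def)
  also have "\<dots> < \<infinity>" using A.rearr_finite[OF g] B.rearr_finite[OF h] by simp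
  finally have c: "c < \<infinity>" .

  define S where "S = {x\<in>{0..}. modulus (f x) > c}"
  have S: "S \<in> sets lam" unfolding S_def using f by (rule sets_modulus_greater)
  have S1: "emeasure lam S \<le> 1"
    using rearr_le_iff[OF f, of 1 c] by (simp add: c_def S_def distr_fun_def)
  define R where "R = (\<lambda>k t. if t \<in> S then k t else Fin 0)"
  have R: "R k \<in> mfun" if "k \<in> mfun" for k unfolding R_def using that S by (rule mfun_restrict)
  have "{x\<in>{0..}. modulus (R g x) \<noteq> 0} \<subseteq> S" by (auto simp: R_def split: if_splits)
  from order_trans[OF emeasure_mono[OF this S] S1]
  have supp: "emeasure lam {x\<in>{0..}. modulus (R g x) \<noteq> 0} \<le> 1" .
  have "A (R g) \<le> A g" by (intro A.norm_mono R g AE_I2) (simp add: R_def)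
  then have "A (R g) < \<infinity>" using g by simp
  \<comment> \<open>\<open>R g\<close> lives on a set of measure at most 1, so
    \<open>local_stronger\<close> carries it from \<open>A\<close> to \<open>B\<close>.\<close>
  then have "B (R g) < \<infinity>"
    using assms(3) R[OF g(1)] A.norm_local_part_eq[OF R supp] B.norm_local_part_eq[OF R supp] g
    by (auto simp: local_stronger_def)
  moreover have "B (R h) \<le> B h" by (intro B.norm_mono R h AE_I2) (simp add: R_def)
  then have "B (R h) < \<infinity>" using h by simp
  moreover have "B (R f) \<le> B (R g) + B (R h)"
    by (intro B.norm_add_le R f g h eventually_mono[OF le]) (simp add: R_def)
  ultimately have Rf: "B (R f) < \<infinity>" by (simp add: order.strict_trans1)
  have const: "(\<lambda>t. c * indicator {0..1} t) \<in> mfun_pos"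
    using unit_split_lam(1) by (simp add: mfun_pos_def)
  \<comment> \<open>At levels of at least \<open>c\<close>, \<open>f\<close> and \<open>R f\<close>
    have the same superlevel sets.\<close>
  have rearr_R: "rearr f t \<le> max c (rearr (R f) t)" for t
  proof -
    let ?a = "max c (rearr (R f) t)"
    have "{x\<in>{0..}. modulus (f x) > ?a} = {x\<in>{0..}. modulus (R f x) > ?a}"
      by (auto simp: R_def S_def)
    then have "distr_fun f ?a = distr_fun (R f) ?a" by (simp add: distr_fun_def)
    also have "\<dots> \<le> ennreal t" by (subst rearr_le_iff[symmetric]) (simp_all add: R f)
    finally show ?thesis by (simp add: rearr_le_iff[OF f])
  qed
  have "B (local_part f) \<le> B (of_pos (\<lambda>t. c * indicator {0..1} t)) + B (of_pos (rearr (R f)))"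
  proof (intro B.norm_add_le local_part_mfun f of_pos_mfun const rearr_mfun_pos R AE_I2)
    fix t
    have "rearr f t \<le> c + rearr (R f) t"
      using rearr_R[of t] by (rule order_trans) (simp add: max_def)
    then show "modulus (local_part f t) \<le>
       modulus (of_pos (\<lambda>t. c * indicator {0..1} t) t) + modulus (of_pos (rearr (R f)) t)"
      by (auto simp: local_part_def indicator_def)
  qed
  also have "\<dots> < \<infinity>"
    using B.norm_const_indicator_finite[OF unit_split_lam(1) _ c] unit_split_lam(3) Rf by (simp add: B.norm_rearr R f)
  finally have loc: "B (local_part f) < \<infinity>" .

  define T where "T = (\<lambda>k::real\<Rightarrow>ecomplex. of_pos (\<lambda>t. min (modulus (k t)) c))"
  have T: "T k \<in> mfun" if "k \<in> mfun" for k
    unfolding T_def using mfun_pos_modulus[OF that] by (intro of_pos_mfun) (simp add: mfun_pos_def)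
  have "A (T g) \<le> A g" by (intro A.norm_mono T g AE_I2) (simp add: T_def)
  then have "A (T g) < \<infinity>" using g by simp
  moreover have "B (global_part h) < \<infinity>" using B.norm_global_part_le[OF h(1)] h(2) by simp
  then have glob: "A (global_part h) < \<infinity>"
    using assms(4) h(1) B.rearr_finite[OF h, of 1] by (auto simp: global_stronger_def)
  have "A (T h) < \<infinity>"
    by (rule A.norm_truncated_finite[OF T[OF h(1)] h(1) c _ _ glob]) (auto simp: T_def)
  \<comment> \<open>Truncation at a fixed height is subadditive.\<close>
  moreover have "min x c \<le> min y c + min z c" if "x \<le> y + z" for x y z
    using that by (auto simp: min_def intro: add_increasing add_increasing2)
  then have "A (T f) \<le> A (T g) + A (T h)"
    by (intro A.norm_add_le T f g h eventually_mono[OF le]) (simp add: T_def)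
  ultimately have Tf: "A (T f) < \<infinity>" by (simp add: order.strict_trans1)
  \<comment> \<open>Below \<open>c\<close>, truncation does not change superlevel sets. Otherwise
    \<open>rearr (T f) t\<close> is at least \<open>c = rearr f 1\<close>, which bounds
    \<open>rearr f t\<close> because \<open>1 \<le> t\<close>.\<close>
  have "rearr f t \<le> rearr (T f) t" if "1 \<le> t" for t
  proof (cases "rearr (T f) t < c")
    case True
    let ?a = "rearr (T f) t"
    have "{x\<in>{0..}. modulus (f x) > ?a} = {x\<in>{0..}. modulus (T f x) > ?a}"
      using True by (auto simp: T_def)
    then have "distr_fun f ?a = distr_fun (T f) ?a" by (simp add: distr_fun_def)
    also have "\<dots> \<le> ennreal t" by (subst rearr_le_iff[symmetric]) (simp_all add: T f)
    finally show ?thesis by (simp add: rearr_le_iff[OF f])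
  next
    case False
    then show ?thesis using antimono_rearr[OF f that] by (simp add: c_def)
  qed
  then have "A (global_part f) \<le> A (of_pos (rearr (T f)))"
    by (intro A.norm_mono global_part_mfun f of_pos_mfun rearr_mfun_pos T AE_I2)
       (auto simp: global_part_def indicator_def)
  with Tf have "A (global_part f) < \<infinity>" by (simp add: A.norm_rearr T f)
  with loc f show "f \<in> space_of (WL_norm B A)" by (simp add: space_of_def WL_norm_def)
qed

theorem corollary3p12:
  fixes A B :: "(real \<Rightarrow> ecomplex) \<Rightarrow> ennreal"
  assumes "ri_banach_function_norm A"
    and "ri_banach_function_norm B"
    and "local_stronger A B"
    and "global_stronger B A"
  shows "space_of A \<inter> space_of B = space_of (WL_norm A B)
      \<and> equivalent_quasinorms (inter_norm A B) (WL_norm A B)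
      \<and> sum_space (space_of A) (space_of B) = space_of (WL_norm B A)"
proof (intro conjI)
  show equiv: "equivalent_quasinorms (inter_norm A B) (WL_norm A B)"
    using assms by (rule inter_norm_equiv_WL_norm)
  have "space_of A \<inter> space_of B = space_of (inter_norm A B)"
    by (auto simp: space_of_def inter_norm_def)
  then show "space_of A \<inter> space_of B = space_of (WL_norm A B)"
    using space_of_eq_of_equivalent[OF equiv] by simp
  show "sum_space (space_of A) (space_of B) = space_of (WL_norm B A)"
    using sum_space_subset_WL[OF assms] WL_subset_sum_space[OF assms(1,2)] by (rule antisym)
qed

end
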